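(* Let $f:\mathbb{R}^n\to\mathbb{R}$ be differentiable with minimum value $f^*$, let $f$ be $L$-smooth and satisfy the Polyak-Łojasiewicz condition with parameter $\mu>0$, and let $\widetilde\nabla f$ satisfy the composite noise condition with parameters $\alpha\in[0,1)$ and $\delta\ge 0$. Then for every starting point $x^0\in\mathbb{R}^n$ and every $N$, the iterates $x^{k}=x^{k-1}-h\,\widetilde\nabla f(x^{k-1})$, $k=1,\dots,N$, with step $$h=\left(\frac{1-\alpha}{1+\alpha}\right)^{3/2}\frac{1}{4L}$$ satisfy $$f(x^N)-f^*\le\left(1-\frac{(1-\alpha)^3}{1+\alpha}\,\frac{\mu}{8L}\right)^N\bigl(f(x^0)-f^*\bigr)+\frac32\,\frac{1+\alpha}{(1-\alpha)^3}\,\frac{\delta^2}{\mu}.$$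
   Context: $\|\cdot\|_2$ is the Euclidean norm. $L$-smooth ($L>0$): $f(y)\le f(x)+\langle\nabla f(x),y-x\rangle+\frac L2\|x-y\|_2^2$ for all $x,y\in\mathbb{R}^n$. Polyak-Łojasiewicz condition with parameter $\mu$: $\frac1{2\mu}\|\nabla f(x)\|_2^2\ge f(x)-f^*$ for all $x$, where $f^*=\min f$ (assumed attained). Composite noise condition with parameters $(\alpha,\delta)$: the map $\widetilde\nabla f:\mathbb{R}^n\to\mathbb{R}^n$ satisfies $\|\widetilde\nabla f(x)-\nabla f(x)\|_2\le\alpha\|\nabla f(x)\|_2+\delta$ for all $x\in\mathbb{R}^n$. *)

theory Defs
  imports "HOL-Analysis.Analysis"
begin

text \<open>
  The gradient of a function, taken with respect to the library's relational notion
  \<^const>\<open>gderiv\<close>. It is meaningful at points of differentiability; see the lemma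
  \<open>GDERIV_gradient\<close> below.
\<close>

definition gradient :: "('a::real_inner \<Rightarrow> real) \<Rightarrow> 'a \<Rightarrow> 'a" where
  "gradient f x = (THE g. GDERIV f x :> g)"

lemma gradient_eqI:
  assumes "GDERIV f x :> g"
  shows "gradient f x = g"
  unfolding gradient_def
proof (rule the_equality)
  fix g'
  assume "GDERIV f x :> g'"
  with assms have "(\<lambda>h. inner h g') = (\<lambda>h. inner h g)"
    unfolding gderiv_def by (rule has_derivative_unique[symmetric])
  then have "inner (g' - g) g' = inner (g' - g) g"
    by (rule fun_cong)
  then have "inner (g' - g) (g' - g) = 0"
    by (simp add: inner_diff_right)
  then show "g' = g"
    by simp
qed (rule assms)

lemma GDERIV_gradient:
  fixes f :: "'a::euclidean_space \<Rightarrow> real"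
  assumes "f differentiable (at x)"
  shows "GDERIV f x :> gradient f x"
proof -
  obtain f' where f': "(f has_derivative f') (at x)"
    using assms unfolding differentiable_def by blast
  then have lin: "linear f'"
    by (rule has_derivative_linear)
  have "f' = (\<lambda>h. inner h (adjoint f' 1))"
    using adjoint_works[OF lin, of _ 1] by (simp add: fun_eq_iff)
  with f' have "GDERIV f x :> adjoint f' 1"
    unfolding gderiv_def by simp
  then show ?thesis
    by (simp add: gradient_eqI)
qed

definition is_min_value :: "('a \<Rightarrow> real) \<Rightarrow> real \<Rightarrow> bool" where
  "is_min_value f m \<longleftrightarrow> m \<in> range f \<and> (\<forall>x. m \<le> f x)"

text \<open>
  Smoothness is the one-sided quadratic upper bound, not Lipschitz continuity of the gradient;
  the two are not equivalent for nonconvex functions.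
\<close>

definition L_smooth :: "real \<Rightarrow> ('a::real_inner \<Rightarrow> real) \<Rightarrow> bool" where
  "L_smooth L f \<longleftrightarrow>
    (\<forall>x y. f y \<le> f x + inner (gradient f x) (y - x) + L / 2 * (norm (x - y))\<^sup>2)"

definition PL_condition :: "real \<Rightarrow> real \<Rightarrow> ('a::real_inner \<Rightarrow> real) \<Rightarrow> bool" where
  "PL_condition \<mu> fstar f \<longleftrightarrow>
    (\<forall>x. 1 / (2 * \<mu>) * (norm (gradient f x))\<^sup>2 \<ge> f x - fstar)"

definition composite_noise ::
    "real \<Rightarrow> real \<Rightarrow> ('a::real_inner \<Rightarrow> real) \<Rightarrow> ('a \<Rightarrow> 'a) \<Rightarrow> bool" where
  "composite_noise \<alpha> \<delta> f g \<longleftrightarrow>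
    (\<forall>x. norm (g x - gradient f x) \<le> \<alpha> * norm (gradient f x) + \<delta>)"

end

theory Submission
  imports Defs
begin

text \<open>
  Put \<open>u = sqrt ((1 - \<alpha>) / (1 + \<alpha>))\<close>, so that \<open>\<alpha> = (1 - u\<^sup>2) / (1 + u\<^sup>2)\<close> and
  \<open>h = u\<^sup>3 / (4 L)\<close>. In these terms the decrease promised by smoothness is a quadratic form in
  the gradient norm and \<open>\<delta>\<close>, polynomial in \<open>u\<close>, and completing the square shows that each step
  gains \<open>(1 - \<alpha>)\<^sup>3 / (1 + \<alpha>) / (16 L)\<close> times the squared gradient norm up to an error of
  \<open>3 \<delta>\<^sup>2 / (16 L)\<close>. The Polyak-Lojasiewicz condition turns this into a linear recursion for
  \<open>f - f\<^sup>*\<close>.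
\<close>

text \<open>The gradient norm is \<open>(1 + u\<^sup>2) p\<close> in the intended application.\<close>

lemma step_quadratic_form_nonneg:
  fixes u p d :: real
  assumes "0 \<le> u" "u \<le> 1" "0 \<le> p" "0 \<le> d"
  shows "0 \<le> 16 * u^5 * (1 + u\<^sup>2) * p\<^sup>2 - 8 * u^3 * (1 + u\<^sup>2) * p * d
    - u^6 * (2 * p + d)\<^sup>2 - 8 * u^6 * p\<^sup>2 + 6 * d\<^sup>2"
proof -
  have "u\<^sup>2 \<le> 1" "u^3 \<le> 1" "u^6 \<le> 1"
    using assms by (auto intro: power_le_one)
  \<comment> \<open>The square takes 20 from the coefficient of \<open>u^3 * p * d\<close>; the
    third summand restores what is excessive, and the factor \<open>(1 - u)\<^sup>2\<close> arises
    from the surplus in \<open>p\<^sup>2\<close>. Every summand is nonnegative for u in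
    [0, 1].\<close>
  then have "0 \<le> 5 * (2 * u^3 * p - d)\<^sup>2 + 4 * u^5 * p\<^sup>2 * (4 * (1 - u)\<^sup>2)
      + 4 * u^3 * (p * d) * (2 * (1 - u\<^sup>2) + (1 - u^3)) + (1 - u^6) * d\<^sup>2"
    using assms by (intro add_nonneg_nonneg mult_nonneg_nonneg) auto
  also have "\<dots> = 16 * u^5 * (1 + u\<^sup>2) * p\<^sup>2 - 8 * u^3 * (1 + u\<^sup>2) * p * d
      - u^6 * (2 * p + d)\<^sup>2 - 8 * u^6 * p\<^sup>2 + 6 * d\<^sup>2"
    by algebra
  finally show ?thesis .
qed

text \<open>The right-hand side is the decrease that smoothness guarantees under the worst noise,
  with \<open>G\<close> the gradient norm. Parametrising by \<open>u\<close> removes the fractional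
  power, and the difference of the two sides becomes the quadratic form above divided by
  \<open>32 * L\<close>.\<close>

lemma step_decrease_bound:
  fixes L \<alpha> d G h :: real
  assumes "0 < L" "0 \<le> \<alpha>" "\<alpha> < 1" "0 \<le> d" "0 \<le> G"
    and h: "h = ((1 - \<alpha>) / (1 + \<alpha>)) powr (3 / 2) * (1 / (4 * L))"
  shows "(1 - \<alpha>)^3 / (1 + \<alpha>) / (16 * L) * G\<^sup>2 - 3 * d\<^sup>2 / (16 * L)
    \<le> h * ((1 - \<alpha>) * G\<^sup>2 - G * d) - L / 2 * h\<^sup>2 * ((1 + \<alpha>) * G + d)\<^sup>2"
proof -
  define u where "u = sqrt ((1 - \<alpha>) / (1 + \<alpha>))"
  define w where "w = 1 + u\<^sup>2"
  \<comment> \<open>This scaling clears denominators: \<open>(1 + \<alpha>) * G = 2 * p\<close> and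
    \<open>(1 - \<alpha>) * G = 2 * u\<^sup>2 * p\<close>.\<close>
  define p where "p = G / w"
  have u: "0 < u" "u \<le> 1" and u2: "u\<^sup>2 = (1 - \<alpha>) / (1 + \<alpha>)"
    using assms unfolding u_def by auto
  have w: "0 < w" "w = 2 / (1 + \<alpha>)"
    using assms by (simp_all add: w_def u2 field_simps)
  have bp: "1 + \<alpha> = 2 / w" and bm: "1 - \<alpha> = 2 * u\<^sup>2 / w"
    using assms by (simp_all add: w(2) u2)
  have G: "G = w * p"
    using w(1) by (simp add: p_def)
  have "((1 - \<alpha>) / (1 + \<alpha>)) powr (3 / 2) = (u powr 2) powr (3 / 2)"
    using u by (simp flip: u2 add: powr_realpow[of u 2, simplified])
  also have "\<dots> = u^3"
    using u(1) powr_realpow[of u 3] by (simp only: powr_powr) simp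
  finally have h': "h = u^3 / (4 * L)"
    by (simp add: h)
  have "0 \<le> (16 * u^5 * w * p\<^sup>2 - 8 * u^3 * w * p * d
      - u^6 * (2 * p + d)\<^sup>2 - 8 * u^6 * p\<^sup>2 + 6 * d\<^sup>2) / (32 * L)"
    using step_quadratic_form_nonneg[of u p d] u w(1) assms by (simp add: p_def w_def[symmetric])
  also have "\<dots> = h * ((1 - \<alpha>) * G\<^sup>2 - G * d) - L / 2 * h\<^sup>2 * ((1 + \<alpha>) * G + d)\<^sup>2
      - ((1 - \<alpha>)^3 / (1 + \<alpha>) / (16 * L) * G\<^sup>2 - 3 * d\<^sup>2 / (16 * L))"
    unfolding bp bm h' G using \<open>0 < L\<close> w(1)
    by (simp add: field_simps power2_eq_square power3_eq_cube eval_nat_numeral)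
  finally show ?thesis
    by simp
qed

text \<open>Noise enters the smoothness bound twice: Cauchy-Schwarz bounds the inner product with
  the true gradient from below, and the triangle inequality bounds the step length from
  above.\<close>

lemma L_smooth_noisy_step:
  fixes f :: "'a::real_inner \<Rightarrow> real"
  assumes "L_smooth L f" "0 < L" "0 \<le> \<alpha>" "\<alpha> < 1" "0 \<le> \<delta>" "composite_noise \<alpha> \<delta> f g"
    and h: "h = ((1 - \<alpha>) / (1 + \<alpha>)) powr (3 / 2) * (1 / (4 * L))"
  shows "f (z - h *\<^sub>R g z) \<le> f z
    - (1 - \<alpha>)^3 / (1 + \<alpha>) / (16 * L) * (norm (gradient f z))\<^sup>2 + 3 * \<delta>\<^sup>2 / (16 * L)"
proof -
  define v where "v = gradient f z"
  have noise: "norm (g z - v) \<le> \<alpha> * norm v + \<delta>"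
    using assms unfolding composite_noise_def v_def by blast
  have "0 \<le> h"
    using \<open>0 < L\<close> by (simp add: h)
  have "inner v (v - g z) \<le> norm v * norm (g z - v)"
    using norm_cauchy_schwarz[of v "v - g z"] by (simp add: norm_minus_commute)
  also have "\<dots> \<le> norm v * (\<alpha> * norm v + \<delta>)"
    by (intro mult_left_mono noise) simp
  finally have inner: "(1 - \<alpha>) * (norm v)\<^sup>2 - norm v * \<delta> \<le> inner v (g z)"
    by (simp add: inner_diff_right power2_norm_eq_inner[symmetric] power2_eq_square algebra_simps)
  have "norm (g z) \<le> norm v + norm (g z - v)"
    by norm
  with noise have "norm (g z) \<le> (1 + \<alpha>) * norm v + \<delta>"
    by (simp add: algebra_simps)
  then have sq: "(norm (g z))\<^sup>2 \<le> ((1 + \<alpha>) * norm v + \<delta>)\<^sup>2"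
    by (intro power_mono) auto
  have "f (z - h *\<^sub>R g z) \<le> f z - h * inner v (g z) + L / 2 * h\<^sup>2 * (norm (g z))\<^sup>2"
    using assms(1)[unfolded L_smooth_def, rule_format, of "z - h *\<^sub>R g z" z]
    by (simp add: v_def power_mult_distrib algebra_simps)
  also have "\<dots> \<le> f z - h * ((1 - \<alpha>) * (norm v)\<^sup>2 - norm v * \<delta>)
      + L / 2 * h\<^sup>2 * ((1 + \<alpha>) * norm v + \<delta>)\<^sup>2"
    using \<open>0 \<le> h\<close> \<open>0 < L\<close> inner sq by (intro add_mono diff_mono mult_left_mono) auto
  also have "\<dots> \<le> f z - (1 - \<alpha>)^3 / (1 + \<alpha>) / (16 * L) * (norm v)\<^sup>2 + 3 * \<delta>\<^sup>2 / (16 * L)"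
    using step_decrease_bound[OF \<open>0 < L\<close> \<open>0 \<le> \<alpha>\<close> \<open>\<alpha> < 1\<close> \<open>0 \<le> \<delta>\<close> norm_ge_zero h, of v] by linarith
  finally show ?thesis
    by (simp add: v_def)
qed

text \<open>An exact gradient step of length \<open>1 / L\<close> lowers \<open>f\<close> by at
  least the squared gradient norm over \<open>2 * L\<close>, yet cannot go below
  \<open>m\<close>.\<close>

lemma L_smooth_norm_gradient_le:
  fixes f :: "'a::real_inner \<Rightarrow> real"
  assumes "L_smooth L f" "0 < L" "\<And>y. m \<le> f y"
  shows "(norm (gradient f z))\<^sup>2 \<le> 2 * L * (f z - m)"
proof -
  define v where "v = gradient f z"
  have "m \<le> f (z - (1 / L) *\<^sub>R v)"
    by (rule assms)
  also have "\<dots> \<le> f z - 1 / L * inner v v + L / 2 * (norm ((1 / L) *\<^sub>R v))\<^sup>2"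
    using assms(1)[unfolded L_smooth_def, rule_format, of "z - (1 / L) *\<^sub>R v" z]
    by (simp add: v_def algebra_simps)
  also have "\<dots> = f z - (norm v)\<^sup>2 / (2 * L)"
    using \<open>0 < L\<close> by (simp add: power2_norm_eq_inner[symmetric] field_simps power2_eq_square)
  finally show ?thesis
    using \<open>0 < L\<close> by (simp add: v_def field_simps)
qed

text \<open>The two conditions bound the squared gradient norm from opposite sides by multiples of
  \<open>f z - m\<close>. The gap must be positive to cancel: a constant \<open>f\<close> admits all
  positive \<mu> and \<open>L\<close>.\<close>

lemma PL_smooth_constants_le:
  fixes f :: "'a::real_inner \<Rightarrow> real"
  assumes "L_smooth L f" "0 < L" "\<And>y. m \<le> f y" "PL_condition \<mu> m f" "0 < \<mu>" "m < f z"
  shows "\<mu> \<le> L"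
proof -
  have "2 * \<mu> * (f z - m) \<le> (norm (gradient f z))\<^sup>2"
    using assms(4)[unfolded PL_condition_def, rule_format, of z] \<open>0 < \<mu>\<close> by (simp add: field_simps)
  also have "\<dots> \<le> 2 * L * (f z - m)"
    using assms by (intro L_smooth_norm_gradient_le)
  finally show ?thesis
    using \<open>m < f z\<close> by simp
qed

lemma contraction_factor_le_one:
  fixes \<alpha> L \<mu> :: real
  assumes "0 \<le> \<alpha>" "\<alpha> < 1" "0 < L" "0 < \<mu>" "\<mu> \<le> L"
  shows "(1 - \<alpha>)^3 / (1 + \<alpha>) * (\<mu> / (8 * L)) \<le> 1"
proof -
  have "(1 - \<alpha>)^3 \<le> 1"
    using assms by (intro power_le_one) auto
  then have "(1 - \<alpha>)^3 / (1 + \<alpha>) \<le> 1"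
    using assms by simp
  moreover have "\<mu> / (8 * L) \<le> 1"
    using assms by simp
  ultimately show ?thesis
    using assms by (intro mult_le_one) auto
qed

theorem theorem5p2:
  fixes f :: "real ^ 'n \<Rightarrow> real"
    and g :: "real ^ 'n \<Rightarrow> real ^ 'n"
    and x :: "nat \<Rightarrow> real ^ 'n"
    and N :: nat
    and L \<mu> \<alpha> \<delta> fstar h :: real
  assumes "\<And>z. f differentiable (at z)"
    and "is_min_value f fstar"
    and "L > 0" and "L_smooth L f"
    and "\<mu> > 0" and "PL_condition \<mu> fstar f"
    and "0 \<le> \<alpha>" and "\<alpha> < 1" and "\<delta> \<ge> 0" and "composite_noise \<alpha> \<delta> f g"
    and "h = ((1 - \<alpha>) / (1 + \<alpha>)) powr (3 / 2) * (1 / (4 * L))"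
    and "\<And>k. k \<in> {1..N} \<Longrightarrow> x k = x (k - 1) - h *\<^sub>R g (x (k - 1))"
  shows "f (x N) - fstar
    \<le> (1 - (1 - \<alpha>) ^ 3 / (1 + \<alpha>) * (\<mu> / (8 * L))) ^ N * (f (x 0) - fstar)
      + 3 / 2 * ((1 + \<alpha>) / (1 - \<alpha>) ^ 3) * (\<delta>\<^sup>2 / \<mu>)"
proof -
  define c where "c = (1 - \<alpha>)^3 / (1 + \<alpha>)"
  define q where "q = c * (\<mu> / (8 * L))"
  \<comment> \<open>\<open>D\<close> is the fixed point of the error recursion
    \<open>e \<mapsto> (1 - q) * e + q * D\<close>, whose additive term is the error of one
    step.\<close>
  define D where "D = 3 / 2 * ((1 + \<alpha>) / (1 - \<alpha>) ^ 3) * (\<delta>\<^sup>2 / \<mu>)"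
  have min: "fstar \<le> f y" for y
    using assms(2) by (simp add: is_min_value_def)
  have c: "0 < c"
    using assms by (simp add: c_def)
  have D: "0 \<le> D"
    using assms by (simp add: D_def)
  have "D = 3 / 2 * (1 / c) * (\<delta>\<^sup>2 / \<mu>)"
    by (simp add: D_def c_def)
  then have qD: "q * D = 3 * \<delta>\<^sup>2 / (16 * L)"
    using assms c by (simp add: q_def field_simps)
  show ?thesis
  \<comment> \<open>Iterating the recursion requires \<open>1 - q\<close> to be nonnegative, which
    follows from \<mu> \<le> \<open>L\<close>. That may fail for constant \<open>f\<close>, but then
    the gap is zero throughout.\<close>
  proof (cases "\<exists>z. fstar < f z")
    case False
    then have "f y = fstar" for y
      using min[of y] by (meson not_le order_antisym)
    then show ?thesis
      using D by (simp add: D_def)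
  next
    case True
    then have "\<mu> \<le> L"
      using PL_smooth_constants_le assms min by metis
    then have q: "q \<le> 1"
      unfolding q_def c_def using assms by (intro contraction_factor_le_one)
    have "f (x n) - fstar \<le> (1 - q)^n * (f (x 0) - fstar) + D" if "n \<le> N" for n
      using that
    proof (induction n)
      case 0
      then show ?case
        using D by simp
    next
      case (Suc n)
      let ?G = "(norm (gradient f (x n)))\<^sup>2"
      have "f (x (Suc n)) \<le> f (x n) - c / (16 * L) * ?G + q * D"
        using L_smooth_noisy_step[of L f \<alpha> \<delta> g h "x n"] assms(12)[of "Suc n"] assms Suc.prems
        by (simp add: c_def qD)
      \<comment> \<open>The Polyak-Lojasiewicz condition trades the gain in squared gradient norm
        for a fraction \<open>q\<close> of the current gap.\<close>
      moreover have "q * (f (x n) - fstar) \<le> q * (1 / (2 * \<mu>) * ?G)"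
        using assms c by (intro mult_left_mono) (auto simp: PL_condition_def q_def)
      moreover have "q * (1 / (2 * \<mu>) * ?G) = c / (16 * L) * ?G"
        using assms by (simp add: q_def)
      ultimately have "f (x (Suc n)) - fstar \<le> (1 - q) * (f (x n) - fstar) + q * D"
        by (simp add: algebra_simps)
      also have "\<dots> \<le> (1 - q) * ((1 - q)^n * (f (x 0) - fstar) + D) + q * D"
        using q Suc by (intro add_right_mono mult_left_mono) auto
      also have "\<dots> = (1 - q)^Suc n * (f (x 0) - fstar) + D"
        by (simp add: algebra_simps)
      finally show ?case .
    qed
    then show ?thesis
      by (simp add: q_def c_def D_def)
  qed
qed

end
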